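(* Let $d\ge 1$, let $w_s\in\mathbb{R}^d$ be fixed, and let $\ell:\mathbb{R}^d\to(0,\infty)$ be a measurable function (the likelihood of the fixed target data $D_t$ as a function of the weights, $\ell(w)=p(D_t\mid w)$). Let $\pi$ denote the density of the standard Gaussian distribution $\mathcal{N}(0,I)$ on $\mathbb{R}^d$, and assume $\int_{\mathbb{R}^d}\ell(w)\,\pi(w)\,dw<\infty$ and $\int_{\mathbb{R}^d}\ell(w_s+u)\,\pi(u)\,du<\infty$. For $\sigma\in(0,\infty)^d$ let $q(\cdot\mid w_s,\sigma)$ and $q(\cdot\mid 0,\sigma)$ be the densities of $\mathcal{N}(w_s,\mathrm{diag}(\sigma^2))$ and $\mathcal{N}(0,\mathrm{diag}(\sigma^2))$ respectively. Let $p(w_t\mid D_t)$ be the posterior density on weights obtained from the prior $p(w_t)=\pi(w_t)$ and the likelihood $\ell(w_t)$, and let $p(\Delta w\mid D_t)$ be the posterior density on perturbations obtained from the same prior $p(\Delta w)=\pi(\Delta w)$ and the likelihood $p(D_t\mid\Delta w)=\ell(w_s+\Delta w)$. Then minimizing over $\sigma$ the Kullback--Leibler divergence between $q(w_t\mid w_s,\sigma)$ and $p(w_t\mid D_t)$ is equivalent to minimizing over $\sigma$ the Kullback--Leibler divergence between $q(\Delta w\mid 0,\sigma)$ and $p(\Delta w\mid D_t)$; that is, the two problems have the same set of minimizers: $$\operatorname*{arg\,min}_{\sigma\in(0,\infty)^d}\mathrm{KL}\big[q(w_t\mid w_s,\sigma)\,\big\|\,p(w_t\mid D_t)\big]=\operatorname*{arg\,min}_{\sigma\in(0,\infty)^d}\mathrm{KL}\big[q(\Delta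 w\mid 0,\sigma)\,\big\|\,p(\Delta w\mid D_t)\big].$$
   Context: The vector $w_s$ is the (constant) parameter vector of a pre-trained source model; the perturbed weights are $w_t=w_s+\Delta w$, where $\Delta w$ is a random perturbation. The notation $\mathrm{diag}(\sigma^2)$ means the diagonal matrix with entries $\sigma_1^2,\dots,\sigma_d^2$. The posteriors are given by Bayes' rule: $$p(w_t\mid D_t)=\frac{\ell(w_t)\,\pi(w_t)}{\int_{\mathbb{R}^d}\ell(w)\,\pi(w)\,dw},\qquad p(\Delta w\mid D_t)=\frac{\ell(w_s+\Delta w)\,\pi(\Delta w)}{\int_{\mathbb{R}^d}\ell(w_s+u)\,\pi(u)\,du}.$$ For probability densities $q,p$ on $\mathbb{R}^d$ with $p>0$, $\mathrm{KL}[q\|p]=\int q\log(q/p)\in[0,+\infty]$. Here $\operatorname{arg\,min}$ denotes the (possibly empty) set of all $\sigma$ attaining the minimum of the extended-real-valued objective over $(0,\infty)^d$. *)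

theory Defs
  imports "HOL-Probability.Probability"
begin

definition diag_matrix :: "real ^ 'n \<Rightarrow> real ^ 'n ^ 'n" where
  "diag_matrix v = (\<chi> i j. if i = j then v $ i else 0)"

definition gaussian_density :: "real ^ 'n \<Rightarrow> real ^ 'n ^ 'n \<Rightarrow> real ^ 'n \<Rightarrow> real" where
  "gaussian_density \<mu> \<Sigma> x =
     exp (- ((x - \<mu>) \<bullet> (matrix_inv \<Sigma> *v (x - \<mu>))) / 2)
       / sqrt ((2 * pi) ^ CARD('n) * det \<Sigma>)"

definition std_gaussian_density :: "real ^ 'n \<Rightarrow> real" where
  "std_gaussian_density = gaussian_density 0 (mat 1)"

definition diag_gaussian_density :: "real ^ 'n \<Rightarrow> real ^ 'n \<Rightarrow> real ^ 'n \<Rightarrow> real" where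
  "diag_gaussian_density \<mu> \<sigma> = gaussian_density \<mu> (diag_matrix (\<chi> i. (\<sigma> $ i)\<^sup>2))"

definition posterior :: "(real ^ 'n \<Rightarrow> real) \<Rightarrow> (real ^ 'n \<Rightarrow> real) \<Rightarrow> real ^ 'n \<Rightarrow> real" where
  "posterior lik prior w = lik w * prior w / (LINT u|lebesgue. lik u * prior u)"

(* The Bochner integral of a non-integrable function is 0, so an extended-real-valued
   integral is built from the positive and negative parts: ennreal sends negative reals to 0. *)
definition extended_integral :: "'a measure \<Rightarrow> ('a \<Rightarrow> real) \<Rightarrow> ereal" where
  "extended_integral M f =
     enn2ereal (\<integral>\<^sup>+ x. ennreal (f x) \<partial>M) - enn2ereal (\<integral>\<^sup>+ x. ennreal (- f x) \<partial>M)"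

(* For probability densities q and p > 0 the negative part has a finite integral
   (since q ln (q / p) \<ge> q - p), so no difference of infinities occurs.
   Where q x = 0 the integrand is 0, as 0 * ln 0 = 0.
   KL_divergence of the library is real-valued and cannot express the value \<infinity>. *)
definition KL :: "(real ^ 'n \<Rightarrow> real) \<Rightarrow> (real ^ 'n \<Rightarrow> real) \<Rightarrow> ereal" where
  "KL q p = extended_integral lebesgue (\<lambda>x. q x * ln (q x / p x))"

definition arg_min_set :: "('a \<Rightarrow> 'b::ord) \<Rightarrow> 'a set \<Rightarrow> 'a set" where
  "arg_min_set f S = {x. is_arg_min f (\<lambda>y. y \<in> S) x}"

end

theory Submission
  imports Defs
begin

text \<open>
  Substituting w = w_s + u turns the first divergence into the second one plus the mean, under
  N(0, diag(sigma^2)), of log pi(u) - log pi(w_s + u) + log Z_w - log Z_u, where Z_w and Z_u are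
  the two evidences. For the standard Gaussian prior this function is affine in u, and the
  variational density is centred, so its mean is the same constant for every sigma. The constant
  is finite, so the two objectives have the same minimizers even where they are infinite.
\<close>

section \<open>Finite shifts of extended-real objectives and integrals\<close>

lemma arg_min_set_cong_shift:
  fixes F G :: "'a \<Rightarrow> ereal" and c :: real
  assumes "\<And>x. x \<in> S \<Longrightarrow> F x = G x + ereal c"
  shows "arg_min_set F S = arg_min_set G S"
proof -
  \<comment> \<open>\<open>is_arg_min\<close> compares values only by \<open><\<close>, and adding a
    real constant preserves and reflects \<open><\<close> on all of \<open>ereal\<close>, infinities
    included.\<close>
  have "F y < F x \<longleftrightarrow> G y < G x" if "x \<in> S" "y \<in> S" for x y
    using that assms by (cases "G x"; cases "G y") auto
  then show ?thesis
    unfolding arg_min_set_def is_arg_min_def by blast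
qed

text \<open>
  Also valid when both parts of f have infinite integral: both sides are then infinite,
  because \<open>\<infinity> - \<infinity> = \<infinity>\<close> in \<^typ>\<open>ereal\<close>.
\<close>

lemma extended_integral_add_integrable:
  assumes [measurable]: "f \<in> borel_measurable M" and g: "integrable M g"
  shows "extended_integral M (\<lambda>x. f x + g x) = extended_integral M f + ereal (integral\<^sup>L M g)"
proof -
  have [measurable]: "g \<in> borel_measurable M"
    using g by auto
  let ?p = "\<lambda>h. \<integral>\<^sup>+x. ennreal (h x) \<partial>M"
  let ?n = "\<lambda>h. \<integral>\<^sup>+x. ennreal (- h x) \<partial>M"
  let ?h = "\<lambda>x. f x + g x"
  have fin: "?p g < \<infinity>" "?n g < \<infinity>"
    using g by (auto simp: real_integrable_def top.not_eq_extremum)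
  \<comment> \<open>With \<open>h = f + g\<close>, the relation between positive and negative parts
    is written without subtraction, so that it can be integrated even when some parts have infinite
    integral.\<close>
  have pw: "ennreal (f x + g x) + (ennreal (- f x) + ennreal (- g x)) =
      ennreal (- (f x + g x)) + (ennreal (f x) + ennreal (g x))" for x
  proof -
    have "ennreal y = ennreal (max 0 y)" for y
      by (auto simp: max_def ennreal_neg)
    then have "ennreal a + (ennreal b + ennreal c) = ennreal (max 0 a + (max 0 b + max 0 c))" for a b c
      by (metis add_nonneg_nonneg ennreal_plus max.cobounded1)
    moreover have "max 0 (f x + g x) + (max 0 (- f x) + max 0 (- g x)) =
        max 0 (- (f x + g x)) + (max 0 (f x) + max 0 (g x))"
      by (simp add: max_def)
    ultimately show ?thesis by (simp only:)
  qed
  have "?p ?h + (?n f + ?n g) = (\<integral>\<^sup>+x. ennreal (?h x) + (ennreal (- f x) + ennreal (- g x)) \<partial>M)"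
    by (simp add: nn_integral_add)
  also have "\<dots> = ?n ?h + (?p f + ?p g)"
    unfolding pw by (simp add: nn_integral_add)
  finally have bal: "?p ?h + (?n f + ?n g) = ?n ?h + (?p f + ?p g)" .
  have le: "ennreal (a + b) \<le> ennreal a + ennreal b" for a b
    by (cases "0 \<le> a"; cases "0 \<le> b") (auto simp: ennreal_neg intro: ennreal_leI simp flip: ennreal_plus)
  have sub: "?p (\<lambda>x. u x + v x) \<le> ?p u + ?p v"
    if [measurable]: "u \<in> borel_measurable M" "v \<in> borel_measurable M" for u v
    by (subst nn_integral_add[symmetric]) (auto intro!: nn_integral_mono le)
  \<comment> \<open>Subadditivity of the positive part, applied to \<open>f + g\<close>, to
    \<open>f = ?h - g\<close> and to their negatives. As both parts of \<open>g\<close> have finite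
    integral, each part of \<open>?h\<close> is infinite exactly when the same part of
    \<open>f\<close> is.\<close>
  have p1: "?p ?h \<le> ?p f + ?p g" and p2: "?p f \<le> ?p ?h + ?n g"
    and n1: "?n ?h \<le> ?n f + ?n g" and n2: "?n f \<le> ?n ?h + ?p g"
    using sub[of f g] sub[of ?h "\<lambda>x. - g x"] sub[of "\<lambda>x. - f x" "\<lambda>x. - g x"]
      sub[of "\<lambda>x. - ?h x" g] by (simp_all add: algebra_simps)
  have ig: "integral\<^sup>L M g = enn2real (?p g) - enn2real (?n g)"
    using g by (rule real_lebesgue_integral_def)
  obtain gp gn where gp: "?p g = ennreal gp" "0 \<le> gp" and gn: "?n g = ennreal gn" "0 \<le> gn"
    using fin by (metis ennreal_cases less_irrefl infinity_ennreal_def)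
  show ?thesis
  proof (cases "?p f = \<infinity> \<or> ?n f = \<infinity>")
    case True
    \<comment> \<open>An infinite positive part makes both sides \<open>\<infinity>\<close>,
      whatever the negative part is; otherwise the negative parts are infinite and both sides are
      \<open>-\<infinity>\<close>.\<close>
    then consider "?p f = \<infinity>" "?p ?h = \<infinity>" | "?p f \<noteq> \<infinity>" "?p ?h \<noteq> \<infinity>" "?n f = \<infinity>" "?n ?h = \<infinity>"
      using p1 p2 n2 fin by (cases "?p f = \<infinity>"; cases "?p ?h = \<infinity>") (auto simp: top_unique ennreal_add_eq_top)
    then show ?thesis
    proof cases
      case 2
      then show ?thesis
        unfolding extended_integral_def 2(3,4)
        by (cases "?p f"; cases "?p ?h") auto
    qed (simp add: extended_integral_def)
  next
    case False
    moreover from this have "?p ?h \<noteq> \<infinity>" "?n ?h \<noteq> \<infinity>"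
      using p1 n1 fin by (auto simp: top_unique ennreal_add_eq_top)
    ultimately obtain fp fn hp hn where
      eqs: "?p f = ennreal fp" "?n f = ennreal fn" "?p ?h = ennreal hp" "?n ?h = ennreal hn"
      and nn: "0 \<le> fp" "0 \<le> fn" "0 \<le> hp" "0 \<le> hn"
      using that[of "enn2real (?p f)" "enn2real (?n f)" "enn2real (?p ?h)" "enn2real (?n ?h)"]
      by (simp add: ennreal_enn2real_if)
    have "hp + (fn + gn) = hn + (fp + gp)"
      using bal nn gp(2) gn(2) unfolding eqs gp(1) gn(1) by (simp flip: ennreal_plus)
    then show ?thesis
      unfolding extended_integral_def ig eqs gp(1) gn(1)
      using nn gp(2) gn(2) by (simp add: enn2ereal_ennreal)
  qed
qed

section \<open>Translation invariance of Lebesgue measure and extended integrals\<close>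

text \<open>Borel measurability does not suffice: the target carries the completed sigma-algebra, so
  null sets must pull back to null sets. Translation is the affine map with all scale factors
  1.\<close>

lemma measurable_add_lebesgue [measurable]:
  "(+) a \<in> lebesgue \<rightarrow>\<^sub>M (lebesgue :: 'a::euclidean_space measure)"
  using lebesgue_affine_measurable[of "\<lambda>_. 1" a] by (simp add: euclidean_representation)

lemma distr_add_lebesgue: "distr lebesgue lebesgue ((+) a) = (lebesgue :: 'a::euclidean_space measure)"
  using lebesgue_affine_euclidean[of "\<lambda>_. 1" a] by (simp add: euclidean_representation density_1)

lemma extended_integral_translate:
  fixes f :: "'a::euclidean_space \<Rightarrow> real"
  assumes [measurable]: "f \<in> borel_measurable lebesgue"
  shows "extended_integral lebesgue (\<lambda>x. f (a + x)) = extended_integral lebesgue f"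
proof -
  have "(\<integral>\<^sup>+x. h (a + x) \<partial>lebesgue) = (\<integral>\<^sup>+x. h x \<partial>lebesgue)"
    if "h \<in> borel_measurable lebesgue" for h :: "'a \<Rightarrow> ennreal"
    using that by (subst (2) distr_add_lebesgue[of a, symmetric]) (simp add: nn_integral_distr)
  from this[of "\<lambda>x. ennreal (f x)"] this[of "\<lambda>x. ennreal (- f x)"] show ?thesis
    by (simp add: extended_integral_def)
qed

section \<open>Diagonal covariances and the product form of the density\<close>

lemma matrix_inv_eqI:
  fixes A B :: "real ^ 'n ^ 'n"
  assumes "A ** B = mat 1"
  shows "matrix_inv A = B"
proof -
  have "B ** A = mat 1"
    using assms by (simp add: matrix_left_right_inverse)
  \<comment> \<open>\<open>matrix_inv\<close> is a Hilbert choice; \<open>B\<close> witnesses that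
    the chosen matrix is a genuine two-sided inverse, and inverses are unique.\<close>
  with assms have "A ** matrix_inv A = mat 1 \<and> matrix_inv A ** A = mat 1"
    unfolding matrix_inv_def
    by (intro someI[where P = "\<lambda>C. A ** C = mat 1 \<and> C ** A = mat 1" and x = B]) simp
  then show ?thesis
    by (metis \<open>B ** A = mat 1\<close> matrix_mul_assoc matrix_mul_lid matrix_mul_rid)
qed

lemma det_diag_matrix: "det (diag_matrix v) = (\<Prod>i\<in>UNIV. v $ i)"
  by (simp add: det_diagonal diag_matrix_def)

lemma matrix_inv_diag_matrix:
  assumes "\<And>i. v $ i \<noteq> 0"
  shows "matrix_inv (diag_matrix v) = diag_matrix (\<chi> i. 1 / v $ i)"
  using assms
  by (intro matrix_inv_eqI)
     (simp add: diag_matrix_def matrix_matrix_mult_def mat_def vec_eq_iff mult_delta_left)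

lemma diag_matrix_mult_vec: "diag_matrix v *v x = (\<chi> i. v $ i * x $ i)"
  by (simp add: diag_matrix_def matrix_vector_mult_def vec_eq_iff mult_delta_left)

text \<open>The real \<open>sqrt\<close> extends oddly to negative arguments and is multiplicative
  everywhere; over an infinite \<open>A\<close> both products are 1.\<close>

lemma sqrt_prod: "sqrt (\<Prod>i\<in>A. f i) = (\<Prod>i\<in>A. sqrt (f i))"
  by (induction A rule: infinite_finite_induct) (simp_all add: real_sqrt_mult)

text \<open>The quadratic form is a sum over coordinates and the determinant a product, so
  one-dimensional facts become available. \<open>normal_density\<close> takes the standard
  deviation, not the variance.\<close>

lemma diag_gaussian_density_eq_prod:
  fixes \<mu> \<sigma> x :: "real ^ 'n"
  assumes "\<And>i. 0 < \<sigma> $ i"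
  shows "diag_gaussian_density \<mu> \<sigma> x = (\<Prod>i\<in>UNIV. normal_density (\<mu> $ i) (\<sigma> $ i) (x $ i))"
proof -
  have "\<sigma> $ i \<noteq> 0" for i
    using assms[of i] by simp
  then have "diag_gaussian_density \<mu> \<sigma> x =
      exp (\<Sum>i\<in>UNIV. - (x $ i - \<mu> $ i)\<^sup>2 / (2 * (\<sigma> $ i)\<^sup>2)) / sqrt (\<Prod>i\<in>UNIV. 2 * pi * (\<sigma> $ i)\<^sup>2)"
    unfolding diag_gaussian_density_def gaussian_density_def
    by (simp add: matrix_inv_diag_matrix diag_matrix_mult_vec det_diag_matrix inner_vec_def
        prod.distrib sum_negf sum_divide_distrib power2_eq_square ac_simps)
  also have "\<dots> = (\<Prod>i\<in>UNIV. normal_density (\<mu> $ i) (\<sigma> $ i) (x $ i))"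
    by (simp add: normal_density_def exp_sum prod_dividef sqrt_prod)
  finally show ?thesis .
qed

section \<open>The standard Gaussian prior\<close>

lemma std_gaussian_density_eq:
  "std_gaussian_density (x :: real ^ 'n) = exp (- (x \<bullet> x) / 2) / sqrt ((2 * pi) ^ CARD('n))"
  using matrix_inv_eqI[of "mat 1 :: real ^ 'n ^ 'n" "mat 1"]
  by (simp add: std_gaussian_density_def gaussian_density_def)

lemma std_gaussian_density_pos: "0 < std_gaussian_density x"
  by (simp add: std_gaussian_density_eq)

lemma borel_measurable_std_gaussian_density [measurable]: "std_gaussian_density \<in> borel_measurable borel"
  unfolding std_gaussian_density_eq[abs_def] by measurable

text \<open>Expanding the square of \<open>a + u\<close>, the term quadratic in \<open>u\<close> is
  the same on both sides; what remains is affine in \<open>u\<close>.\<close>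

lemma ln_std_gaussian_density_add:
  "ln (std_gaussian_density (a + u)) = ln (std_gaussian_density u) - (a \<bullet> u + a \<bullet> a / 2)"
proof -
  have "std_gaussian_density (a + u) = std_gaussian_density u * exp (- (a \<bullet> u + a \<bullet> a / 2))"
    by (simp add: std_gaussian_density_eq inner_add_left inner_add_right inner_commute
        field_simps flip: exp_add)
  then show ?thesis
    using std_gaussian_density_pos[of u] by (simp add: ln_mult)
qed

section \<open>Total mass and first moments of the variational density\<close>

lemma nn_integral_lborel_prod_cart:
  assumes [measurable]: "\<And>i::'n::finite. f i \<in> borel_measurable borel" and "\<And>i y. 0 \<le> f i y"
  shows "(\<integral>\<^sup>+x. ennreal (\<Prod>i\<in>UNIV. f i (x $ i)) \<partial>(lborel :: (real ^ 'n) measure)) =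
    (\<Prod>i\<in>UNIV. \<integral>\<^sup>+y. ennreal (f i y) \<partial>lborel)"
proof -
  \<comment> \<open>Tonelli for \<open>lborel\<close> is indexed by \<open>Basis\<close>;
    \<open>i \<mapsto> axis i 1\<close> maps the coordinates bijectively onto it, and
    \<open>axis_index\<close> goes back.\<close>
  define k where "k b = axis_index (b :: real ^ 'n)" for b
  have B: "(\<Prod>b\<in>Basis. h b) = (\<Prod>i\<in>UNIV. h (axis i 1))" for h :: "real ^ 'n \<Rightarrow> ennreal"
    by (simp add: Basis_vec_def UNION_singleton_eq_range prod.reindex axis_eq_axis inj_on_def)
  have "(\<integral>\<^sup>+x. (\<Prod>b\<in>Basis. ennreal (f (k b) (x \<bullet> b))) \<partial>lborel) =
      (\<Prod>b\<in>Basis. \<integral>\<^sup>+y. ennreal (f (k b) y) \<partial>lborel)"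
    by (rule nn_integral_lborel_prod) auto
  then show ?thesis
    using assms(2) by (simp add: B k_def inner_axis prod_ennreal)
qed

context
  fixes \<sigma> :: "real ^ 'n"
  assumes sigma_pos: "\<And>i. 0 < \<sigma> $ i"
begin

lemma diag_gaussian_density_pos: "0 < diag_gaussian_density \<mu> \<sigma> x"
  by (simp add: diag_gaussian_density_eq_prod sigma_pos normal_density_pos prod_pos)

lemma borel_measurable_diag_gaussian_density [measurable]:
  "diag_gaussian_density \<mu> \<sigma> \<in> borel_measurable borel"
  unfolding diag_gaussian_density_eq_prod[OF sigma_pos, abs_def] by measurable

lemma diag_gaussian_density_translate:
  "diag_gaussian_density a \<sigma> (a + u) = diag_gaussian_density 0 \<sigma> u"
  by (simp add: diag_gaussian_density_def gaussian_density_def)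

lemma diag_gaussian_density_uminus: "diag_gaussian_density 0 \<sigma> (- u) = diag_gaussian_density 0 \<sigma> u"
  by (simp add: diag_gaussian_density_eq_prod sigma_pos normal_density_def)

lemma nn_integral_diag_gaussian_density:
  "(\<integral>\<^sup>+x. ennreal (diag_gaussian_density \<mu> \<sigma> x) \<partial>lborel) = 1"
  unfolding diag_gaussian_density_eq_prod[OF sigma_pos]
  by (subst nn_integral_lborel_prod_cart)
     (simp_all add: nn_integral_eq_integral sigma_pos)

lemma has_bochner_integral_diag_gaussian_density:
  "has_bochner_integral lborel (diag_gaussian_density \<mu> \<sigma>) 1"
  using diag_gaussian_density_pos
  by (intro has_bochner_integral_nn_integral)
     (auto simp: nn_integral_diag_gaussian_density less_imp_le)

text \<open>The absolute value of \<open>x $ j\<close> is absorbed into factor \<open>j\<close>, so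
  the integrand stays a product: Tonelli leaves one first absolute moment and total masses, all
  finite.\<close>

lemma integrable_diag_gaussian_density_component:
  "integrable lborel (\<lambda>x. diag_gaussian_density 0 \<sigma> x * x $ j)"
proof (rule integrableI_bounded)
  let ?f = "\<lambda>i y. normal_density 0 (\<sigma> $ i) y * (if i = j then \<bar>y\<bar> else 1)"
  have "ennreal (norm (diag_gaussian_density 0 \<sigma> x * x $ j)) = ennreal (\<Prod>i\<in>UNIV. ?f i (x $ i))" for x
    by (simp add: diag_gaussian_density_eq_prod sigma_pos abs_mult prod.distrib prod_nonneg)
  then have "(\<integral>\<^sup>+x. ennreal (norm (diag_gaussian_density 0 \<sigma> x * x $ j)) \<partial>lborel) =
      (\<Prod>i\<in>UNIV. \<integral>\<^sup>+y. ennreal (?f i y) \<partial>lborel)"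
    by (simp only:) (rule nn_integral_lborel_prod_cart, auto)
  also have "\<dots> < \<infinity>"
  proof -
    have "(\<integral>\<^sup>+y. ennreal (?f i y) \<partial>lborel) < \<infinity>" for i
      using integrable_normal_moment_abs[OF sigma_pos, of 0 i 1] integrable_normal_density[OF sigma_pos, of 0 i]
      by (cases "i = j") (auto simp: nn_integral_eq_integral)
    then show ?thesis
      by (simp add: less_top[symmetric] ennreal_prod_eq_top)
  qed
  finally show "(\<integral>\<^sup>+x. ennreal (norm (diag_gaussian_density 0 \<sigma> x * x $ j)) \<partial>lborel) < \<infinity>" .
qed measurable

text \<open>The density is even and the inner product odd, so reflection shows the integral to be
  its own negative. Integrability needs the separate coordinatewise argument, since a Bochner
  integral equal to 0 does not imply it.\<close>

lemma has_bochner_integral_diag_gaussian_density_inner: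
  "has_bochner_integral lborel (\<lambda>x. diag_gaussian_density 0 \<sigma> x * (a \<bullet> x)) 0"
proof -
  let ?f = "\<lambda>x. diag_gaussian_density 0 \<sigma> x * (a \<bullet> x)"
  have "?f = (\<lambda>x. \<Sum>j\<in>UNIV. a $ j * (diag_gaussian_density 0 \<sigma> x * x $ j))"
    by (simp add: inner_vec_def sum_distrib_left ac_simps)
  then have int: "integrable lborel ?f"
    using integrable_diag_gaussian_density_component by simp
  have "distr lborel borel uminus = (lborel :: (real ^ 'n) measure)"
    by (subst lborel_affine[of "-1" 0]) (auto simp: density_1)
  then have "integral\<^sup>L lborel ?f = integral\<^sup>L (distr lborel borel uminus) ?f"
    by simp
  also have "\<dots> = - integral\<^sup>L lborel ?f"
    by (subst integral_distr) (auto simp: diag_gaussian_density_uminus)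
  finally show ?thesis
    using int by (simp add: has_bochner_integral_iff)
qed

text \<open>The mean does not depend on \<open>\<sigma>\<close>, which makes the gap between the two
  objectives constant.\<close>

lemma has_bochner_integral_diag_gaussian_density_affine:
  "has_bochner_integral lebesgue (\<lambda>x. diag_gaussian_density 0 \<sigma> x * (a \<bullet> x + c)) c"
proof -
  have "has_bochner_integral lborel
      (\<lambda>x. diag_gaussian_density 0 \<sigma> x * (a \<bullet> x) + diag_gaussian_density 0 \<sigma> x * c) (0 + 1 * c)"
    by (intro has_bochner_integral_add has_bochner_integral_diag_gaussian_density_inner
        has_bochner_integral_mult_left has_bochner_integral_diag_gaussian_density)
  then show ?thesis
    by (simp add: has_bochner_integral_iff integrable_completion integral_completion distrib_left)
qed

end

section \<open>Positivity of the evidences\<close>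

lemma evidence_pos:
  fixes lik :: "real ^ 'n \<Rightarrow> real"
  assumes [measurable]: "lik \<in> borel_measurable lebesgue" and pos: "\<And>w. 0 < lik w"
    and fin: "(\<integral>\<^sup>+ w. ennreal (lik w * std_gaussian_density w) \<partial>lebesgue) < \<infinity>"
  shows "0 < (LINT w|lebesgue. lik w * std_gaussian_density w)"
proof -
  let ?f = "\<lambda>w. lik w * std_gaussian_density w"
  have fpos: "0 < ?f w" for w
    by (intro mult_pos_pos pos std_gaussian_density_pos)
  have [measurable]: "std_gaussian_density \<in> borel_measurable lebesgue"
    by (rule measurable_completion) simp
  \<comment> \<open>Finiteness rules out that the Bochner integral is merely the default value
    0.\<close>
  have int: "integrable lebesgue ?f"
    using fin by (intro integrableI_nonneg) (auto intro: less_imp_le fpos)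
  \<comment> \<open>An everywhere positive function can vanish almost everywhere only if the whole
    space is null.\<close>
  have "\<not> (AE w in lebesgue. ?f w = 0)"
  proof
    assume "AE w in lebesgue. ?f w = 0"
    then have "AE w in (lebesgue :: (real ^ 'n) measure). False"
      by eventually_elim (use fpos in \<open>simp add: less_le\<close>)
    then show False
      by (simp add: trivial_limit_def[symmetric] ae_filter_eq_bot_iff)
  qed
  then have "integral\<^sup>L lebesgue ?f \<noteq> 0"
    using integral_nonneg_eq_0_iff_AE[OF int] fpos by (auto intro: less_imp_le)
  moreover have "0 \<le> integral\<^sup>L lebesgue ?f"
    by (intro Bochner_Integration.integral_nonneg) (auto intro: less_imp_le fpos)
  ultimately show ?thesis by simp
qed

section \<open>Comparison of the two divergences\<close>

theorem mainTheorem1: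
  fixes w\<^sub>s :: "real ^ 'n" and lik :: "real ^ 'n \<Rightarrow> real"
  assumes lik_measurable: "lik \<in> borel_measurable lebesgue"
    and lik_pos: "\<And>w. 0 < lik w"
    and fin_weights: "(\<integral>\<^sup>+ w. ennreal (lik w * std_gaussian_density w) \<partial>lebesgue) < \<infinity>"
    and fin_perturb: "(\<integral>\<^sup>+ u. ennreal (lik (w\<^sub>s + u) * std_gaussian_density u) \<partial>lebesgue) < \<infinity>"
  shows
    "arg_min_set
       (\<lambda>\<sigma>. KL (diag_gaussian_density w\<^sub>s \<sigma>) (posterior lik std_gaussian_density))
       {\<sigma>. \<forall>i. 0 < \<sigma> $ i} =
     arg_min_set
       (\<lambda>\<sigma>. KL (diag_gaussian_density 0 \<sigma>)
               (posterior (\<lambda>u. lik (w\<^sub>s + u)) std_gaussian_density))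
       {\<sigma>. \<forall>i. 0 < \<sigma> $ i}"
proof -
  define Z\<^sub>w Z\<^sub>u
    where "Z\<^sub>w = (LINT w|lebesgue. lik w * std_gaussian_density w)"
      and "Z\<^sub>u = (LINT u|lebesgue. lik (w\<^sub>s + u) * std_gaussian_density u)"
  \<comment> \<open>The constant part of the log-ratio of the two posteriors: the half square comes
    from shifting the prior, the logarithms from the normalizations.\<close>
  define c where "c = w\<^sub>s \<bullet> w\<^sub>s / 2 + ln Z\<^sub>w - ln Z\<^sub>u"
  note [measurable] = lik_measurable
  have lik_shift [measurable]: "(\<lambda>u. lik (w\<^sub>s + u)) \<in> borel_measurable lebesgue"
    using measurable_compose[OF measurable_add_lebesgue lik_measurable] .
  have Z_pos: "0 < Z\<^sub>w" "0 < Z\<^sub>u"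
    unfolding Z\<^sub>w_def Z\<^sub>u_def
    using evidence_pos[OF lik_measurable lik_pos fin_weights]
      evidence_pos[OF lik_shift lik_pos fin_perturb] by auto
  have [measurable]: "std_gaussian_density \<in> borel_measurable (lebesgue :: (real ^ 'n) measure)"
    by (rule measurable_completion) simp
  let ?P = "posterior lik std_gaussian_density"
  let ?R = "posterior (\<lambda>u. lik (w\<^sub>s + u)) std_gaussian_density"
  have [measurable]: "?P \<in> borel_measurable lebesgue" "?R \<in> borel_measurable lebesgue"
    unfolding posterior_def[abs_def] by measurable
  have "KL (diag_gaussian_density w\<^sub>s \<sigma>) ?P = KL (diag_gaussian_density 0 \<sigma>) ?R + ereal c"
    if "\<sigma> \<in> {\<sigma>. \<forall>i. 0 < \<sigma> $ i}" for \<sigma>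
  proof -
    have sp: "\<And>i. 0 < \<sigma> $ i"
      using that by simp
    have [measurable]: "diag_gaussian_density \<mu> \<sigma> \<in> borel_measurable lebesgue" for \<mu>
      by (rule measurable_completion) (simp add: borel_measurable_diag_gaussian_density sp)
    let ?q = "diag_gaussian_density 0 \<sigma>"
    have shifted: "diag_gaussian_density w\<^sub>s \<sigma> (w\<^sub>s + u) *
          ln (diag_gaussian_density w\<^sub>s \<sigma> (w\<^sub>s + u) / ?P (w\<^sub>s + u)) =
        ?q u * ln (?q u / ?R u) + ?q u * (w\<^sub>s \<bullet> u + c)" for u
    proof -
      \<comment> \<open>General \<open>v\<close> and \<open>Z\<close> cover both posteriors:
        \<open>w\<^sub>s + u\<close> with \<open>Z\<^sub>w\<close>, and \<open>u\<close> with
        \<open>Z\<^sub>u\<close>. Both evaluate the likelihood at \<open>w\<^sub>s + u\<close>, so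
        its logarithm cancels in the comparison.\<close>
      have "ln (?q u / (lik (w\<^sub>s + u) * std_gaussian_density v / Z)) =
          ln (?q u) - ln (lik (w\<^sub>s + u)) - ln (std_gaussian_density v) + ln Z" if "0 < Z" for v :: "real ^ 'n" and Z
        using that diag_gaussian_density_pos[OF sp, of 0 u] lik_pos[of "w\<^sub>s + u"] std_gaussian_density_pos[of v]
        by (simp add: ln_div ln_mult)
      then have "ln (?q u / ?P (w\<^sub>s + u)) = ln (?q u / ?R u) + (w\<^sub>s \<bullet> u + c)"
        using Z_pos by (simp add: posterior_def c_def ln_std_gaussian_density_add flip: Z\<^sub>w_def Z\<^sub>u_def)
      then show ?thesis
        by (simp add: diag_gaussian_density_translate sp distrib_left)
    qed
    have affine: "has_bochner_integral lebesgue (\<lambda>u. ?q u * (w\<^sub>s \<bullet> u + c)) c"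
      by (rule has_bochner_integral_diag_gaussian_density_affine) (rule sp)
    have "KL (diag_gaussian_density w\<^sub>s \<sigma>) ?P =
        extended_integral lebesgue (\<lambda>u. diag_gaussian_density w\<^sub>s \<sigma> (w\<^sub>s + u) *
          ln (diag_gaussian_density w\<^sub>s \<sigma> (w\<^sub>s + u) / ?P (w\<^sub>s + u)))"
      unfolding KL_def by (rule extended_integral_translate[symmetric]) measurable
    \<comment> \<open>Only the affine correction is known to be integrable; the divergence may be
      infinite, hence additivity in extended form.\<close>
    also have "\<dots> = KL ?q ?R + ereal c"
      unfolding shifted KL_def
      using affine by (subst extended_integral_add_integrable) (auto simp: has_bochner_integral_iff)
    finally show ?thesis .
  qed
  then show ?thesis
    by (rule arg_min_set_cong_shift)
qed

end
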